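(* For every $k\ge 2$, any asymptotically exact streaming algorithm for estimating $F_k$ under insertions and deletions requires $\Omega(n)$ memory.
   Context: The input is a stream of updates, each inserting or deleting one copy of an integer from $[N]$; after a prefix of length $n$, $m_i$ is the current multiplicity of $i$ and $F_k=\sum_{i=1}^N m_i^k$. An asymptotically exact streaming algorithm for $F_k$ here means a one-pass streaming algorithm that, on an infinite update stream, after every prefix of length $n$ maintains an estimate $\tilde F_k$ with, with probability at least $1-\delta$ ($\delta<1/2$), $\tilde F_k/F_k\to1$ as $n\to\infty$; the claim is that any such algorithm uses $\Omega(n)$ bits of memory in the worst case.
   Formalization: The universe size N is taken to depend on the stream length n with N(n) = Ω(n), and the algorithm may depend on N; for fixed N, or N not Ω(n), the claim fails because exact counters use o(n) bits. *)

theory Defs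
  imports "HOL-Probability.Probability" "HOL-Library.Landau_Symbols"
begin

datatype update = Insert nat | Delete nat

primrec item :: "update \<Rightarrow> nat" where
  "item (Insert i) = i"
| "item (Delete i) = i"

text \<open>An infinite stream is a function \<open>us\<close>; its prefix of length \<open>n\<close> is
  \<open>us 0, \<dots>, us (n - 1)\<close>.\<close>

definition multiplicity_after :: "(nat \<Rightarrow> update) \<Rightarrow> nat \<Rightarrow> nat \<Rightarrow> int" where
  "multiplicity_after us n i =
     int (card {t. t < n \<and> us t = Insert i}) - int (card {t. t < n \<and> us t = Delete i})"

text \<open>Only a copy that is present can be deleted, so multiplicities never become negative.\<close>

definition update_stream :: "nat \<Rightarrow> (nat \<Rightarrow> update) \<Rightarrow> bool" where
  "update_stream N us \<longleftrightarrow>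
     (\<forall>t. item (us t) \<in> {1..N}) \<and> (\<forall>n i. 0 \<le> multiplicity_after us n i)"

definition frequency_moment :: "nat \<Rightarrow> nat \<Rightarrow> (nat \<Rightarrow> update) \<Rightarrow> nat \<Rightarrow> real" where
  "frequency_moment k N us n = (\<Sum>i=1..N. real_of_int (multiplicity_after us n i) ^ k)"

text \<open>A randomized one-pass algorithm whose memory is a bit string. The randomness is one
  outcome \<open>\<omega>\<close> of an arbitrary probability space, and the number of updates processed so far is
  passed to \<open>step\<close> and \<open>answer\<close>; neither is charged as memory. An algorithm that tosses fresh
  coins at every update is the instance where \<open>coins\<close> is a product over the update times and
  \<open>step\<close> at time \<open>t\<close> reads only the component of \<open>\<omega>\<close> belonging to \<open>t\<close>.\<close>

record 'w streaming_alg =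
  coins :: "'w measure"
  init :: "'w \<Rightarrow> bool list"
  step :: "'w \<Rightarrow> nat \<Rightarrow> update \<Rightarrow> bool list \<Rightarrow> bool list"
  answer :: "'w \<Rightarrow> nat \<Rightarrow> bool list \<Rightarrow> real"

primrec memory_after :: "'w streaming_alg \<Rightarrow> (nat \<Rightarrow> update) \<Rightarrow> 'w \<Rightarrow> nat \<Rightarrow> bool list" where
  "memory_after A us \<omega> 0 = init A \<omega>"
| "memory_after A us \<omega> (Suc n) = step A \<omega> n (us n) (memory_after A us \<omega> n)"

definition estimate :: "'w streaming_alg \<Rightarrow> (nat \<Rightarrow> update) \<Rightarrow> 'w \<Rightarrow> nat \<Rightarrow> real" where
  "estimate A us \<omega> n = answer A \<omega> n (memory_after A us \<omega> n)"

text \<open>The ratio of estimate and moment is undefined when the moment is \<open>0\<close> (the current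
  multiset is empty), so convergence is only demanded on streams whose moment is eventually
  positive; with \<open>x / 0 = 0\<close> no algorithm could satisfy it on the others. A non-measurable
  event has \<open>measure\<close> \<open>0\<close>, so for \<open>\<delta> < 1\<close> the bound includes measurability of the event.\<close>

definition asymptotically_exact ::
  "nat \<Rightarrow> real \<Rightarrow> nat \<Rightarrow> 'w streaming_alg \<Rightarrow> bool" where
  "asymptotically_exact k \<delta> N A \<longleftrightarrow>
     prob_space (coins A) \<and>
     (\<forall>us. update_stream N us \<and> (\<forall>\<^sub>F n in sequentially. frequency_moment k N us n > 0) \<longrightarrow>
        \<P>(\<omega> in coins A.
            (\<lambda>n. estimate A us \<omega> n / frequency_moment k N us n) \<longlonglongrightarrow> 1) \<ge> 1 - \<delta>)"

definition worst_case_memory :: "nat \<Rightarrow> 'w streaming_alg \<Rightarrow> nat \<Rightarrow> enat" where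
  "worst_case_memory N A n =
     (SUP (us, \<omega>) \<in> {us. update_stream N us} \<times> space (coins A).
        enat (length (memory_after A us \<omega> n)))"

end

theory Submission
  imports Defs
begin

text \<open>
  The proof reduces from the one-way communication problem INDEX. A set \<open>S \<subseteq> {..<m}\<close> is
  encoded in a prefix of \<open>n\<close> insertions, and \<open>j \<in> S\<close> is queried by inserting and deleting item
  \<open>j + 1\<close> forever: the moment then oscillates between two constants whose difference
  \<open>(x + 1) ^ k - x ^ k\<close> determines the multiplicity \<open>x\<close> of that item because \<open>k \<ge> 2\<close>, and
  asymptotically exact estimates reveal this difference. Hence the memory content at time \<open>n\<close>
  determines each bit of \<open>S\<close> with probability at least \<open>1 - \<delta>\<close>. Averaging over \<open>S\<close> and \<open>j\<close> fixes
  the randomness, and an exponential-moment bound shows that the remaining deterministic code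
  needs \<open>exp ((1 - 2 * \<delta>)\<^sup>2 * m / 2)\<close> memory contents.
\<close>

section \<open>Codes that determine most of the encoded bits\<close>

lemma cosh_le_exp_half_square: "cosh x \<le> exp (x\<^sup>2 / 2)" for x :: real
proof -
  define y where "y = \<bar>x\<bar>"
  have mix: "1 + 1 / 2 * (exp (2 * y) - 1) = exp y * cosh y"
    by (simp add: cosh_field_def field_simps flip: exp_add)
  have "- (2 * y) * (1 / 2) + ln (1 + 1 / 2 * (exp (2 * y) - 1)) \<le> (2 * y)\<^sup>2 / 8"
    by (intro Hoeffdings_lemma_aux) (auto simp: y_def)
  then have "ln (cosh y) \<le> y\<^sup>2 / 2"
    unfolding mix by (simp add: ln_mult cosh_real_pos power2_eq_square)
  then have "cosh y \<le> exp (y\<^sup>2 / 2)"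
    by (metis cosh_real_pos exp_le_cancel_iff exp_ln)
  then show ?thesis
    by (simp add: y_def)
qed

lemma card_times_exp_le_sum_exp:
  fixes f :: "'a \<Rightarrow> real"
  assumes "real (card I) * a \<le> (\<Sum>i\<in>I. f i)"
  shows "real (card I) * exp a \<le> (\<Sum>i\<in>I. exp (f i))"
proof -
  \<comment> \<open>Jensen's inequality for \<open>exp\<close>, via its tangent at \<open>a\<close>\<close>
  have "real (card I) * exp a
      \<le> exp a * (real (card I) + ((\<Sum>i\<in>I. f i) - real (card I) * a))"
    using assms by (simp add: algebra_simps)
  also have "\<dots> = (\<Sum>i\<in>I. exp a * (1 + (f i - a)))"
    by (simp add: sum.distrib sum_subtractf flip: sum_distrib_left)
  also have "\<dots> \<le> (\<Sum>i\<in>I. exp a * exp (f i - a))"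
    by (intro sum_mono mult_left_mono exp_ge_add_one_self) auto
  also have "\<dots> = (\<Sum>i\<in>I. exp (f i))"
    by (simp flip: exp_add)
  finally show ?thesis .
qed

definition correlation :: "'a set \<Rightarrow> 'a set \<Rightarrow> 'a set \<Rightarrow> real" where
  "correlation J S T = (\<Sum>j\<in>J. if j \<in> S \<longleftrightarrow> j \<in> T then 1 else - 1)"

lemma sum_exp_correlation:
  assumes "finite J"
  shows "(\<Sum>S\<in>Pow J. exp (l * correlation J S T)) = (2 * cosh l) ^ card J"
proof -
  define f where "f j = exp (if j \<in> T then l else - l)" for j
  define g where "g j = exp (if j \<in> T then - l else l)" for j
  have "exp (l * correlation J S T) = (\<Prod>j\<in>S. f j) * (\<Prod>j\<in>J - S. g j)" if "S \<subseteq> J" for S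
  proof -
    have "exp (l * correlation J S T) = (\<Prod>j\<in>J. exp (if j \<in> S \<longleftrightarrow> j \<in> T then l else - l))"
      unfolding correlation_def sum_distrib_left exp_sum[OF assms]
      by (intro prod.cong) auto
    also have "\<dots> = (\<Prod>j\<in>S. exp (if j \<in> S \<longleftrightarrow> j \<in> T then l else - l))
        * (\<Prod>j\<in>J - S. exp (if j \<in> S \<longleftrightarrow> j \<in> T then l else - l))"
      by (simp only: prod.subset_diff[OF that assms] mult.commute)
    also have "\<dots> = (\<Prod>j\<in>S. f j) * (\<Prod>j\<in>J - S. g j)"
      by (intro arg_cong2[where f = "(*)"] prod.cong) (auto simp: f_def g_def)
    finally show ?thesis .
  qed
  then have "(\<Sum>S\<in>Pow J. exp (l * correlation J S T)) = (\<Prod>j\<in>J. f j + g j)"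
    using assms by (simp add: prod_add)
  also have "\<dots> = (\<Prod>j\<in>J. 2 * cosh l)"
    by (intro prod.cong) (auto simp: f_def g_def cosh_field_def)
  finally show ?thesis
    by simp
qed

lemma exp_le_card_codewords_of_correlation:
  fixes enc :: "'a set \<Rightarrow> 'q" and dec :: "'q \<Rightarrow> 'a set"
  assumes "finite J"
    and correlated: "2 ^ card J * (l * real (card J)) \<le> (\<Sum>S\<in>Pow J. correlation J S (dec (enc S)))"
    and "0 \<le> l"
  shows "exp (l\<^sup>2 * real (card J) / 2) \<le> real (card (enc ` Pow J))"
proof -
  define h where "h = l\<^sup>2 * real (card J) / 2"
  let ?Q = "enc ` Pow J"
  have "2 ^ card J * (2 * h) = l * (2 ^ card J * (l * real (card J)))"
    by (simp add: h_def power2_eq_square)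
  also have "\<dots> \<le> l * (\<Sum>S\<in>Pow J. correlation J S (dec (enc S)))"
    using correlated \<open>0 \<le> l\<close> by (rule mult_left_mono)
  finally have "2 ^ card J * exp (2 * h)
      \<le> (\<Sum>S\<in>Pow J. exp (l * correlation J S (dec (enc S))))"
    using card_times_exp_le_sum_exp[where I = "Pow J"] \<open>finite J\<close>
    by (simp add: card_Pow sum_distrib_left)
  also have "\<dots> \<le> (\<Sum>S\<in>Pow J. \<Sum>q\<in>?Q. exp (l * correlation J S (dec q)))"
    using \<open>finite J\<close> by (intro sum_mono member_le_sum[where i = "enc _"]) auto
  also have "\<dots> = (\<Sum>q\<in>?Q. \<Sum>S\<in>Pow J. exp (l * correlation J S (dec q)))"
    by (rule sum.swap)
  also have "\<dots> = real (card ?Q) * (2 * cosh l) ^ card J"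
    by (simp add: sum_exp_correlation[OF \<open>finite J\<close>])
  also have "\<dots> \<le> real (card ?Q) * (2 * exp (l\<^sup>2 / 2)) ^ card J"
    using cosh_le_exp_half_square by (intro mult_left_mono power_mono) auto
  also have "\<dots> = 2 ^ card J * (real (card ?Q) * exp h)"
    by (simp add: power_mult_distrib h_def mult_ac flip: exp_of_nat_mult)
  finally have "exp h * exp h \<le> real (card ?Q) * exp h"
    by (simp flip: exp_add)
  then show ?thesis
    by (simp add: h_def)
qed

lemma exp_le_card_codewords:
  fixes enc :: "'a set \<Rightarrow> 'q" and p :: real
  assumes "finite J" and G: "G \<subseteq> Pow J \<times> J"
    and determined: "\<And>S S' j. (S, j) \<in> G \<Longrightarrow> (S', j) \<in> G \<Longrightarrow> enc S = enc S' \<Longrightarrow> j \<in> S \<longleftrightarrow> j \<in> S'"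
    and large: "p * real (card (Pow J \<times> J)) \<le> real (card G)" and "1 / 2 \<le> p"
  shows "exp ((2 * p - 1)\<^sup>2 * real (card J) / 2) \<le> real (card (enc ` Pow J))"
proof -
  define dec where "dec q = {j. \<exists>S. (S, j) \<in> G \<and> enc S = q \<and> j \<in> S}" for q
  have "j \<in> S \<longleftrightarrow> j \<in> dec (enc S)" if "(S, j) \<in> G" for S j
    using determined that unfolding dec_def by blast
  then have "(\<Sum>j\<in>J. 2 * of_bool ((S, j) \<in> G) - 1) \<le> correlation J S (dec (enc S))" for S
    unfolding correlation_def by (intro sum_mono) auto
  then have "(\<Sum>S\<in>Pow J. \<Sum>j\<in>J. 2 * of_bool ((S, j) \<in> G) - 1)
      \<le> (\<Sum>S\<in>Pow J. correlation J S (dec (enc S)))"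
    by (intro sum_mono)
  moreover have "(\<Sum>S\<in>Pow J. \<Sum>j\<in>J. 2 * of_bool ((S, j) \<in> G) - 1 :: real)
      = (\<Sum>x\<in>Pow J \<times> J. 2 * of_bool (x \<in> G) - 1)"
    by (simp add: sum.cartesian_product)
  moreover have "\<dots> = 2 * real (card G) - real (card (Pow J \<times> J))"
    using \<open>finite J\<close> G by (simp add: sum_subtractf Int_absorb1 flip: sum_distrib_left)
  moreover have "2 ^ card J * ((2 * p - 1) * real (card J))
      = 2 * (p * real (card (Pow J \<times> J))) - real (card (Pow J \<times> J))"
    using \<open>finite J\<close> by (simp add: card_cartesian_product card_Pow algebra_simps)
  ultimately have "2 ^ card J * ((2 * p - 1) * real (card J))
      \<le> (\<Sum>S\<in>Pow J. correlation J S (dec (enc S)))"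
    using large by linarith
  with \<open>finite J\<close> show ?thesis
    using \<open>1 / 2 \<le> p\<close> by (intro exp_le_card_codewords_of_correlation[where dec = dec]) auto
qed

lemma card_bool_lists_length_le: "card {xs :: bool list. length xs \<le> L} \<le> 2 ^ Suc L"
proof -
  have "card {xs :: bool list. length xs \<le> L} = (\<Sum>i\<le>L. 2 ^ i)"
    using card_lists_length_le[of "UNIV :: bool set" L] by simp
  also have "\<dots> = 2 ^ Suc L - 1"
    by (induction L) auto
  finally show ?thesis
    by simp
qed

section \<open>Update streams\<close>

lemma multiplicity_after_0 [simp]: "multiplicity_after us 0 i = 0"
  by (simp add: multiplicity_after_def)

lemma multiplicity_after_Suc:
  "multiplicity_after us (Suc n) i =
     multiplicity_after us n i + of_bool (us n = Insert i) - of_bool (us n = Delete i)"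
proof -
  have "{t. t < Suc n \<and> us t = u}
      = (if us n = u then insert n {t. t < n \<and> us t = u} else {t. t < n \<and> us t = u})" for u
    by (auto simp: less_Suc_eq)
  then show ?thesis
    by (simp add: multiplicity_after_def)
qed

lemma multiplicity_after_cong:
  assumes "\<And>t. t < n \<Longrightarrow> us t = us' t"
  shows "multiplicity_after us n i = multiplicity_after us' n i"
  using assms by (induction n) (auto simp: multiplicity_after_Suc)

lemma multiplicity_after_insertions:
  "multiplicity_after (\<lambda>t. Insert (f t)) n i = int (card {t. t < n \<and> f t = i})"
  by (simp add: multiplicity_after_def)

lemma update_stream_insertions:
  "(\<And>t. f t \<in> {1..N}) \<Longrightarrow> update_stream N (\<lambda>t. Insert (f t))"
  by (simp add: update_stream_def multiplicity_after_insertions)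

lemma frequency_moment_pos:
  assumes "update_stream N us" and "i \<in> {1..N}" and "0 < multiplicity_after us n i"
  shows "0 < frequency_moment k N us n"
  unfolding frequency_moment_def
  using assms by (intro sum_pos2[of _ i]) (auto simp: update_stream_def)

lemma frequency_moment_insertions_pos:
  assumes "\<And>t. f t \<in> {1..N}" and "0 < n"
  shows "0 < frequency_moment k N (\<lambda>t. Insert (f t)) n"
proof (rule frequency_moment_pos)
  show "0 < multiplicity_after (\<lambda>t. Insert (f t)) n (f 0)"
    using assms(2) by (auto simp: multiplicity_after_insertions card_gt_0_iff)
qed (use assms in \<open>auto intro: update_stream_insertions\<close>)

lemma memory_after_cong:
  assumes "\<And>t. t < n \<Longrightarrow> us t = us' t"
  shows "memory_after A us \<omega> n = memory_after A us' \<omega> n"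
  using assms by (induction n) auto

lemma memory_after_resume:
  assumes "memory_after A us \<omega> n = memory_after A us' \<omega> n" and "\<And>t. n \<le> t \<Longrightarrow> us t = us' t"
  shows "memory_after A us \<omega> (n + r) = memory_after A us' \<omega> (n + r)"
  using assms by (induction r) auto

lemma length_memory_after_le_worst_case_memory:
  assumes "update_stream N us" and "\<omega> \<in> space (coins A)"
  shows "enat (length (memory_after A us \<omega> n)) \<le> worst_case_memory N A n"
  unfolding worst_case_memory_def using assms by (intro SUP_upper2[of "(us, \<omega>)"]) auto

section \<open>Querying a multiplicity by toggling an item\<close>

definition toggle_after :: "nat \<Rightarrow> nat \<Rightarrow> (nat \<Rightarrow> update) \<Rightarrow> nat \<Rightarrow> update" where
  "toggle_after n i us t = (if t < n then us t else if even (t - n) then Insert i else Delete i)"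

lemma multiplicity_after_toggle_after:
  "multiplicity_after (toggle_after n i us) (n + r) i' =
     multiplicity_after us n i' + of_bool (odd r \<and> i' = i)"
proof (induction r)
  case 0
  have "multiplicity_after (toggle_after n i us) n i' = multiplicity_after us n i'"
    by (rule multiplicity_after_cong) (simp add: toggle_after_def)
  then show ?case
    by simp
qed (auto simp: multiplicity_after_Suc toggle_after_def)

lemma update_stream_toggle_after:
  assumes "update_stream N us" and "i \<in> {1..N}"
  shows "update_stream N (toggle_after n i us)"
  unfolding update_stream_def
proof (intro conjI allI)
  show "item (toggle_after n i us t) \<in> {1..N}" for t
    using assms by (auto simp: update_stream_def toggle_after_def)
  show "0 \<le> multiplicity_after (toggle_after n i us) t i'" for t i'
  proof (cases "t \<le> n")
    case True
    then have "multiplicity_after (toggle_after n i us) t i' = multiplicity_after us t i'"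
      by (intro multiplicity_after_cong) (auto simp: toggle_after_def)
    then show ?thesis
      using assms(1) by (simp add: update_stream_def)
  next
    case False
    then obtain r where "t = n + r"
      using nat_le_linear le_Suc_ex by blast
    then show ?thesis
      using assms(1) by (simp add: update_stream_def multiplicity_after_toggle_after)
  qed
qed

definition insertion_gain :: "nat \<Rightarrow> int \<Rightarrow> real" where
  "insertion_gain k x = (real_of_int x + 1) ^ k - real_of_int x ^ k"

lemma insertion_gain_nonneg: "0 \<le> x \<Longrightarrow> 0 \<le> insertion_gain k x"
  by (simp add: insertion_gain_def power_mono)

lemma insertion_gain_strict_mono:
  assumes "2 \<le> k" and "0 \<le> x" and "x < y"
  shows "insertion_gain k x < insertion_gain k y"
  using assms(1)
proof (induction k rule: nat_induct_at_least)
  case base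
  then show ?case
    using assms(3) by (simp add: insertion_gain_def power2_eq_square algebra_simps)
next
  case (Suc k)
  have gain_Suc: "insertion_gain (Suc k) z
      = (real_of_int z + 1) * insertion_gain k z + real_of_int z ^ k" for z
    by (simp add: insertion_gain_def algebra_simps)
  have "(real_of_int x + 1) * insertion_gain k x < (real_of_int y + 1) * insertion_gain k y"
    using Suc.IH assms by (intro mult_strict_mono insertion_gain_nonneg) auto
  moreover have "real_of_int x ^ k \<le> real_of_int y ^ k"
    using assms by (intro power_mono) auto
  ultimately show ?case
    unfolding gain_Suc by linarith
qed

lemma frequency_moment_toggle_after:
  assumes "i \<in> {1..N}"
  shows "frequency_moment k N (toggle_after n i us) (n + r) =
    frequency_moment k N us n + (if odd r then insertion_gain k (multiplicity_after us n i) else 0)"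
proof -
  let ?x = "\<lambda>i'. real_of_int (multiplicity_after us n i')"
  let ?d = "if odd r then insertion_gain k (multiplicity_after us n i) else 0"
  have "frequency_moment k N (toggle_after n i us) (n + r)
      = (\<Sum>i'=1..N. ?x i' ^ k + (if i' = i then ?d else 0))"
    unfolding frequency_moment_def multiplicity_after_toggle_after
    by (intro sum.cong) (auto simp: insertion_gain_def)
  also have "\<dots> = frequency_moment k N us n + ?d"
    using assms by (simp add: sum.distrib frequency_moment_def)
  finally show ?thesis .
qed

lemma frequency_moment_toggle_after_ge:
  assumes "update_stream N us" and "i \<in> {1..N}"
  shows "frequency_moment k N us n \<le> frequency_moment k N (toggle_after n i us) (n + r)"
  using assms
  by (auto simp: frequency_moment_toggle_after update_stream_def intro: insertion_gain_nonneg)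

lemma eventually_frequency_moment_toggle_after_pos:
  assumes "update_stream N us" and "i \<in> {1..N}" and "0 < frequency_moment k N us n"
  shows "\<forall>\<^sub>F t in sequentially. 0 < frequency_moment k N (toggle_after n i us) t"
  using eventually_ge_at_top[of n]
proof eventually_elim
  case (elim t)
  then obtain r where "t = n + r"
    using le_Suc_ex by blast
  then show ?case
    using assms(3) frequency_moment_toggle_after_ge[OF assms(1,2), of k n r] by simp
qed

definition exact_in_limit ::
  "nat \<Rightarrow> nat \<Rightarrow> 'w streaming_alg \<Rightarrow> (nat \<Rightarrow> update) \<Rightarrow> 'w \<Rightarrow> bool" where
  "exact_in_limit k N A us \<omega> \<longleftrightarrow>
     (\<lambda>n. estimate A us \<omega> n / frequency_moment k N us n) \<longlonglongrightarrow> 1"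

lemma estimate_tendsto_of_constant_moment:
  assumes "exact_in_limit k N A us \<omega>" and "strict_mono s"
    and "\<And>r. frequency_moment k N us (s r) = F" and "F \<noteq> 0"
  shows "(\<lambda>r. estimate A us \<omega> (s r)) \<longlonglongrightarrow> F"
proof -
  have "(\<lambda>r. estimate A us \<omega> (s r) / F) \<longlonglongrightarrow> 1"
    using LIMSEQ_subseq_LIMSEQ[OF assms(1)[unfolded exact_in_limit_def] assms(2)] assms(3)
    by (simp add: o_def)
  then show ?thesis
    using tendsto_mult_left[of "\<lambda>r. estimate A us \<omega> (s r) / F" 1 sequentially F] \<open>F \<noteq> 0\<close> by simp
qed

lemma estimate_increment_tendsto_insertion_gain:
  assumes "exact_in_limit k N A (toggle_after n i us) \<omega>" and "update_stream N us"
    and "i \<in> {1..N}" and "0 < frequency_moment k N us n"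
  shows "(\<lambda>r. estimate A (toggle_after n i us) \<omega> (n + (2 * r + 1))
             - estimate A (toggle_after n i us) \<omega> (n + 2 * r))
           \<longlonglongrightarrow> insertion_gain k (multiplicity_after us n i)"
proof -
  let ?F = "frequency_moment k N us n" and ?d = "insertion_gain k (multiplicity_after us n i)"
  have "0 \<le> ?d"
    using assms(2) by (simp add: update_stream_def insertion_gain_nonneg)
  then have "(\<lambda>r. estimate A (toggle_after n i us) \<omega> (n + (2 * r + 1))) \<longlonglongrightarrow> ?F + ?d"
    using assms(4)
    by (intro estimate_tendsto_of_constant_moment[OF assms(1)])
       (auto simp: strict_mono_def frequency_moment_toggle_after[OF assms(3)] simp del: add_Suc_right)
  moreover have "(\<lambda>r. estimate A (toggle_after n i us) \<omega> (n + 2 * r)) \<longlonglongrightarrow> ?F"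
    using assms(4)
    by (intro estimate_tendsto_of_constant_moment[OF assms(1)])
       (auto simp: strict_mono_def frequency_moment_toggle_after[OF assms(3)])
  ultimately show ?thesis
    using tendsto_diff by fastforce
qed

lemma memory_determines_multiplicity:
  assumes "2 \<le> k" and "i \<in> {1..N}" and "update_stream N us" and "update_stream N us'"
    and "0 < frequency_moment k N us n" and "0 < frequency_moment k N us' n"
    and "exact_in_limit k N A (toggle_after n i us) \<omega>"
    and "exact_in_limit k N A (toggle_after n i us') \<omega>"
    and "memory_after A us \<omega> n = memory_after A us' \<omega> n"
  shows "multiplicity_after us n i = multiplicity_after us' n i"
proof -
  have prefix: "memory_after A (toggle_after n i vs) \<omega> n = memory_after A vs \<omega> n" for vs
    by (rule memory_after_cong) (simp add: toggle_after_def)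
  have "memory_after A (toggle_after n i us) \<omega> (n + r)
      = memory_after A (toggle_after n i us') \<omega> (n + r)" for r
    by (rule memory_after_resume) (auto simp: prefix assms(9) toggle_after_def)
  then have same_estimate: "estimate A (toggle_after n i us) \<omega> (n + r)
      = estimate A (toggle_after n i us') \<omega> (n + r)" for r
    by (simp add: estimate_def)
  have "insertion_gain k (multiplicity_after us n i)
      = insertion_gain k (multiplicity_after us' n i)"
    using estimate_increment_tendsto_insertion_gain[OF assms(7,3,2,5)]
      estimate_increment_tendsto_insertion_gain[OF assms(8,4,2,6)]
    unfolding same_estimate by (rule LIMSEQ_unique)
  moreover have "0 \<le> multiplicity_after us n i" "0 \<le> multiplicity_after us' n i"
    using assms(3,4) by (auto simp: update_stream_def)
  ultimately show ?thesis
    using insertion_gain_strict_mono[OF assms(1)] by (metis linorder_neqE less_irrefl)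
qed

section \<open>The memory bound\<close>

lemma (in prob_space) exists_outcome_in_many_events:
  fixes E :: "'b \<Rightarrow> 'a set" and p :: real
  assumes "finite I" and "\<And>i. i \<in> I \<Longrightarrow> E i \<in> events" and "\<And>i. i \<in> I \<Longrightarrow> p \<le> prob (E i)"
  shows "\<exists>\<omega>\<in>space M. p * real (card I) \<le> real (card {i \<in> I. \<omega> \<in> E i})"
proof -
  define X :: "'a \<Rightarrow> real" where "X \<omega> = (\<Sum>i\<in>I. indicator (E i) \<omega>)" for \<omega>
  have X_card: "X \<omega> = real (card {i \<in> I. \<omega> \<in> E i})" for \<omega>
    using assms(1) by (simp add: X_def indicator_def Int_def)
  have integrable: "integrable M X"
    unfolding X_def using assms(2)
    by (intro Bochner_Integration.integrable_sum integrable_real_indicator)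
       (auto simp: emeasure_eq_measure)
  have "p * real (card I) = (\<Sum>i\<in>I. p)"
    by simp
  also have "\<dots> \<le> (\<Sum>i\<in>I. prob (E i))"
    using assms(3) by (rule sum_mono)
  also have "\<dots> = expectation X"
    unfolding X_def using assms(2)
    by (subst Bochner_Integration.integral_sum) (auto simp: emeasure_eq_measure)
  finally have "\<not> (AE \<omega> in M. X \<omega> < p * real (card I))"
    using expectation_less[OF integrable] by fastforce
  then show ?thesis
    unfolding X_card by (meson AE_I2 not_less)
qed

lemma asymptotically_exact_common_coins:
  assumes "asymptotically_exact k \<delta> N A" and "\<delta> < 1" and "finite I"
    and "\<And>i. i \<in> I \<Longrightarrow> update_stream N (us i)"
    and "\<And>i. i \<in> I \<Longrightarrow> \<forall>\<^sub>F n in sequentially. 0 < frequency_moment k N (us i) n"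
  obtains \<omega> where "\<omega> \<in> space (coins A)"
    and "(1 - \<delta>) * real (card I) \<le> real (card {i \<in> I. exact_in_limit k N A (us i) \<omega>})"
proof -
  interpret prob_space "coins A"
    using assms(1) by (simp add: asymptotically_exact_def)
  define E where "E i = {\<omega> \<in> space (coins A). exact_in_limit k N A (us i) \<omega>}" for i
  have prob_E: "1 - \<delta> \<le> prob (E i)" if "i \<in> I" for i
    using assms(1,4,5) that by (simp add: asymptotically_exact_def exact_in_limit_def E_def)
  then have E_events: "E i \<in> events" if "i \<in> I" for i
    using that \<open>\<delta> < 1\<close> measure_notin_sets[of "E i" "coins A"] by force
  obtain \<omega> where "\<omega> \<in> space (coins A)"
    and "(1 - \<delta>) * real (card I) \<le> real (card {i \<in> I. \<omega> \<in> E i})"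
    using exists_outcome_in_many_events[of I E "1 - \<delta>"] assms(3) E_events prob_E by blast
  then show thesis
    using that by (simp add: E_def)
qed

text \<open>Elements outside \<open>S\<close> are replaced by the padding item \<open>m + 1\<close>, so that the code has
  the same length for every \<open>S\<close>.\<close>

definition set_item :: "nat \<Rightarrow> nat set \<Rightarrow> nat \<Rightarrow> nat" where
  "set_item m S t = (if t \<in> S then Suc t else Suc m)"

abbreviation set_stream :: "nat \<Rightarrow> nat set \<Rightarrow> nat \<Rightarrow> update" where
  "set_stream m S \<equiv> \<lambda>t. Insert (set_item m S t)"

lemma set_item_in_range: "S \<subseteq> {..<m} \<Longrightarrow> m < N \<Longrightarrow> set_item m S t \<in> {1..N}"
  by (auto simp: set_item_def)

lemma multiplicity_after_set_stream:
  assumes "j < m" and "m \<le> n"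
  shows "multiplicity_after (set_stream m S) n (Suc j) = of_bool (j \<in> S)"
proof -
  have "{t. t < n \<and> set_item m S t = Suc j} = (if j \<in> S then {j} else {})"
    using assms by (auto simp: set_item_def)
  then show ?thesis
    by (simp add: multiplicity_after_insertions)
qed

lemma exp_le_card_memory_contents:
  assumes "2 \<le> k" and "\<delta> < 1 / 2" and "asymptotically_exact k \<delta> N A" and "m < N" and "m \<le> n"
  obtains \<omega> where "\<omega> \<in> space (coins A)"
    and "exp ((1 - 2 * \<delta>)\<^sup>2 * real m / 2)
           \<le> real (card ((\<lambda>S. memory_after A (set_stream m S) \<omega> n) ` Pow {..<m}))"
proof -
  let ?I = "Pow {..<m} \<times> {..<m}"
  let ?query = "\<lambda>(S, j). toggle_after n (Suc j) (set_stream m S)"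
  have stream: "update_stream N (set_stream m S)" if "S \<subseteq> {..<m}" for S
    using set_item_in_range[OF that \<open>m < N\<close>] by (rule update_stream_insertions)
  have pos: "0 < frequency_moment k N (set_stream m S) n" if "S \<subseteq> {..<m}" "j < m" for S j
    using set_item_in_range[OF that(1) \<open>m < N\<close>] that(2) \<open>m \<le> n\<close>
    by (intro frequency_moment_insertions_pos) auto
  obtain \<omega> where \<omega>: "\<omega> \<in> space (coins A)"
    and many: "(1 - \<delta>) * real (card ?I)
      \<le> real (card {x \<in> ?I. exact_in_limit k N A (?query x) \<omega>})"
  proof (rule asymptotically_exact_common_coins[OF assms(3), of ?I ?query])
    fix x assume "x \<in> ?I"
    then show "update_stream N (?query x)"
      and "\<forall>\<^sub>F t in sequentially. 0 < frequency_moment k N (?query x) t"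
      using stream pos \<open>m < N\<close>
      by (auto intro!: update_stream_toggle_after eventually_frequency_moment_toggle_after_pos)
  qed (use assms(2) in auto)
  have "j \<in> S \<longleftrightarrow> j \<in> S'"
    if "S \<subseteq> {..<m}" "S' \<subseteq> {..<m}" "j < m" "exact_in_limit k N A (?query (S, j)) \<omega>"
      "exact_in_limit k N A (?query (S', j)) \<omega>"
      "memory_after A (set_stream m S) \<omega> n = memory_after A (set_stream m S') \<omega> n" for S S' j
    using memory_determines_multiplicity[OF assms(1) _ stream[OF that(1)] stream[OF that(2)]
        pos[OF that(1,3)] pos[OF that(2,3)], of "Suc j" A \<omega>] that(3-) \<open>m < N\<close> \<open>m \<le> n\<close>
    by (simp add: multiplicity_after_set_stream of_bool_eq_iff)
  then have "exp ((2 * (1 - \<delta>) - 1)\<^sup>2 * real (card {..<m}) / 2)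
      \<le> real (card ((\<lambda>S. memory_after A (set_stream m S) \<omega> n) ` Pow {..<m}))"
    using many assms(2)
    by (intro exp_le_card_codewords[where G = "{x \<in> ?I. exact_in_limit k N A (?query x) \<omega>}"]) auto
  then show thesis
    using that[OF \<omega>] by simp
qed

lemma asymptotically_exact_memory_bound:
  assumes "2 \<le> k" and "\<delta> < 1 / 2" and "asymptotically_exact k \<delta> N A" and "m < N" and "m \<le> n"
  shows "ereal ((1 - 2 * \<delta>)\<^sup>2 / 2 * real m - 1) \<le> ereal_of_enat (worst_case_memory N A n)"
proof (cases "worst_case_memory N A n")
  case (enat L)
  obtain \<omega> where \<omega>: "\<omega> \<in> space (coins A)"
    and many: "exp ((1 - 2 * \<delta>)\<^sup>2 * real m / 2)
      \<le> real (card ((\<lambda>S. memory_after A (set_stream m S) \<omega> n) ` Pow {..<m}))"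
    using exp_le_card_memory_contents[OF assms] .
  have "length (memory_after A (set_stream m S) \<omega> n) \<le> L" if "S \<subseteq> {..<m}" for S
    using length_memory_after_le_worst_case_memory[OF update_stream_insertions \<omega>]
      set_item_in_range[OF that \<open>m < N\<close>] enat by (metis enat_ord_simps(1))
  moreover have "finite {xs :: bool list. length xs \<le> L}"
    using finite_lists_length_le[of "UNIV :: bool set" L] by simp
  ultimately have "card ((\<lambda>S. memory_after A (set_stream m S) \<omega> n) ` Pow {..<m})
      \<le> card {xs :: bool list. length xs \<le> L}"
    by (intro card_mono) auto
  also have "\<dots> \<le> 2 ^ Suc L"
    by (rule card_bool_lists_length_le)
  finally have "exp ((1 - 2 * \<delta>)\<^sup>2 * real m / 2) \<le> real (2 ^ Suc L)"
    using many by (meson of_nat_mono order_trans)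
  also have "\<dots> \<le> exp 1 ^ Suc L"
    unfolding of_nat_power using exp_ge_add_one_self[of 1] by (intro power_mono) auto
  also have "\<dots> = exp (real L + 1)"
    by (simp add: exp_add flip: exp_of_nat_mult)
  finally show ?thesis
    using enat by simp
qed simp

lemma bigomega_min_pred:
  assumes "(\<lambda>n. real (N n)) \<in> \<Omega>(\<lambda>n. real n)"
  shows "(\<lambda>n. real (min n (N n - 1))) \<in> \<Omega>(\<lambda>n. real n)"
proof -
  obtain b where "0 < b" and N_ge: "\<forall>\<^sub>F n in sequentially. b * real n \<le> real (N n)"
    using landau_omega.bigE[OF assms] by auto
  have "\<forall>\<^sub>F n in sequentially. 2 / b \<le> real n"
    by (rule eventually_compose_filterlim[OF eventually_ge_at_top filterlim_real_sequentially])
  with N_ge have "\<forall>\<^sub>F n in sequentially.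
      min 1 (b / 2) * norm (real n) \<le> norm (real (min n (N n - 1)))"
  proof eventually_elim
    case (elim n)
    have "min 1 (b / 2) * real n \<le> b / 2 * real n"
      by (intro mult_right_mono) auto
    also have "\<dots> \<le> real (N n) - 1"
      using elim \<open>0 < b\<close> by (simp add: field_simps)
    also have "\<dots> \<le> real (N n - 1)"
      by linarith
    finally show ?case
      using mult_right_mono[of "min 1 (b / 2)" 1 "real n"] by (simp add: of_nat_min)
  qed
  then show ?thesis
    using \<open>0 < b\<close> by (intro landau_omega.bigI[of "min 1 (b / 2)"]) auto
qed

lemma bigomega_linear_lower_bound:
  fixes f :: "nat \<Rightarrow> real"
  assumes "f \<in> \<Omega>(\<lambda>n. real n)" and "\<And>n. 0 \<le> f n" and "0 < s"
  obtains c where "0 < c" and "\<forall>\<^sub>F n in sequentially. c * real n \<le> s * f n - d"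
proof -
  obtain a where "0 < a" and f_ge: "\<forall>\<^sub>F n in sequentially. a * real n \<le> f n"
    using landau_omega.bigE[OF assms(1)] assms(2) by auto
  define c where "c = s * a / 2"
  have "0 < c"
    using \<open>0 < a\<close> \<open>0 < s\<close> by (simp add: c_def)
  have "\<forall>\<^sub>F n in sequentially. d / c \<le> real n"
    by (rule eventually_compose_filterlim[OF eventually_ge_at_top filterlim_real_sequentially])
  with f_ge have "\<forall>\<^sub>F n in sequentially. c * real n \<le> s * f n - d"
  proof eventually_elim
    case (elim n)
    have "2 * (c * real n) \<le> s * f n"
      using mult_left_mono[OF elim(1), of s] \<open>0 < s\<close> by (simp add: c_def)
    moreover have "d \<le> c * real n"
      using elim(2) \<open>0 < c\<close> by (simp add: field_simps)
    ultimately show ?case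
      by linarith
  qed
  with \<open>0 < c\<close> show thesis
    by (rule that)
qed

theorem theorem7:
  fixes k :: nat and \<delta> :: real and A :: "nat \<Rightarrow> 'w streaming_alg" and N :: "nat \<Rightarrow> nat"
  assumes "k \<ge> 2"
    and "\<delta> < 1 / 2"
    and "\<forall>M. asymptotically_exact k \<delta> M (A M)"
    and "(\<lambda>n. real (N n)) \<in> \<Omega>(\<lambda>n. real n)"
  shows "\<exists>c>0. \<forall>\<^sub>F n in sequentially.
           ereal (c * real n) \<le> ereal_of_enat (worst_case_memory (N n) (A (N n)) n)"
proof -
  have scale_pos: "0 < (1 - 2 * \<delta>)\<^sup>2 / 2"
    using assms(2) by simp
  obtain c where "c > 0" and linear: "\<forall>\<^sub>F n in sequentially.
      c * real n \<le> (1 - 2 * \<delta>)\<^sup>2 / 2 * real (min n (N n - 1)) - 1"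
    using bigomega_linear_lower_bound[OF bigomega_min_pred[OF assms(4)] of_nat_0_le_iff scale_pos]
    by blast
  from linear have "\<forall>\<^sub>F n in sequentially.
      ereal (c * real n) \<le> ereal_of_enat (worst_case_memory (N n) (A (N n)) n)"
  proof eventually_elim
    case (elim n)
    have "0 \<le> c * real n"
      using \<open>c > 0\<close> by simp
    with elim have "min n (N n - 1) < N n"
      by (cases "N n") auto
    from elim have "ereal (c * real n)
        \<le> ereal ((1 - 2 * \<delta>)\<^sup>2 / 2 * real (min n (N n - 1)) - 1)"
      by simp
    also have "\<dots> \<le> ereal_of_enat (worst_case_memory (N n) (A (N n)) n)"
      using assms(1-3) \<open>min n (N n - 1) < N n\<close>
      by (intro asymptotically_exact_memory_bound) auto
    finally show ?case .
  qed
  with \<open>c > 0\<close> show ?thesis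
    by blast
qed

end
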